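(* Let $p>1$, let $(a_n)_{n\ge1}$ be a sequence of non-negative real numbers and let $(\lambda_n)_{n\ge1}$ be a sequence of positive real numbers. Define $A_n=\lambda_1a_1+\cdots+\lambda_na_n$ and $\Lambda_n=\lambda_1+\cdots+\lambda_n$ for $n\ge 1$. Then for every positive integer $N$, $$\sum_{n=1}^N\lambda_n\Big(\frac{A_n}{\Lambda_n}\Big)^p\le\frac{p}{p-1}\sum_{n=1}^N\lambda_na_n\Big(\frac{A_n}{\Lambda_n}\Big)^{p-1}-\frac{1}{p-1}\Lambda_N\Big(\frac{A_N}{\Lambda_N}\Big)^p .$$ *)

theory Defs
  imports Complex_Main
begin

definition weight_sum :: "(nat \<Rightarrow> real) \<Rightarrow> nat \<Rightarrow> real" where
  "weight_sum w n = (\<Sum>k=1..n. w k)"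

definition weighted_sum :: "(nat \<Rightarrow> real) \<Rightarrow> (nat \<Rightarrow> real) \<Rightarrow> nat \<Rightarrow> real" where
  "weighted_sum w a n = (\<Sum>k=1..n. w k * a k)"

end

theory Submission
  imports Defs "HOL-Analysis.Convex"
begin

text \<open>
  Write \<open>x n = A n / \<Lambda> n\<close>, so that \<open>\<lambda> n * a n = \<Lambda> n * x n - \<Lambda> (n - 1) * x (n - 1)\<close>. After multiplication by
  \<open>p - 1\<close>, passing from \<open>n\<close> to \<open>n + 1\<close> amounts to Young's inequality
  \<open>p * x n * x (n + 1) powr (p - 1) \<le> (p - 1) * x (n + 1) powr p + x n powr p\<close>, weighted by \<open>\<Lambda> n\<close>.
\<close>

text \<open>Weighted AM-GM for \<open>x powr p\<close> and \<open>y powr p\<close> with weights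
  \<open>(p - 1) / p\<close> and \<open>1 / p\<close>, multiplied by \<open>p\<close>. At zero the
  left side vanishes, since \<open>0 powr r = 0\<close>.\<close>

lemma Young_powr:
  fixes x y p :: real
  assumes "p > 1" "x \<ge> 0" "y \<ge> 0"
  shows "p * y * x powr (p - 1) \<le> (p - 1) * x powr p + y powr p"
proof (cases "x = 0 \<or> y = 0")
  case True
  then show ?thesis using assms by auto
next
  case False
  then have pos: "x > 0" "y > 0" using assms by auto
  have "(x powr p) powr ((p - 1) / p) * (y powr p) powr (1 / p)
      \<le> (p - 1) / p * x powr p + 1 / p * y powr p"
    using assms pos by (intro Youngs_inequality_0) (auto simp: field_simps)
  then have "x powr (p - 1) * y \<le> ((p - 1) * x powr p + y powr p) / p"
    using assms pos by (simp add: powr_powr add_divide_distrib)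
  then show ?thesis
    using assms by (simp add: pos_le_divide_eq mult_ac)
qed

text \<open>Clearing the denominator \<open>p - 1\<close> and moving the boundary term to the left
  gives a form suited to induction, which can start at the trivial case
  \<open>N = 0\<close>.\<close>

lemma weighted_mean_sum_powr_le:
  fixes p :: real and a w :: "nat \<Rightarrow> real"
  assumes p: "p > 1"
    and a: "\<And>n. n \<ge> 1 \<Longrightarrow> a n \<ge> 0"
    and w: "\<And>n. n \<ge> 1 \<Longrightarrow> w n > 0"
  shows "(p - 1) * (\<Sum>n=1..N. w n * (weighted_sum w a n / weight_sum w n) powr p)
      + weight_sum w N * (weighted_sum w a N / weight_sum w N) powr p
    \<le> p * (\<Sum>n=1..N. w n * a n * (weighted_sum w a n / weight_sum w n) powr (p - 1))"
proof (induction N)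
  case 0
  then show ?case by (simp add: weight_sum_def)
next
  case (Suc N)
  define x where "x n = weighted_sum w a n / weight_sum w n" for n
  have L_nonneg: "weight_sum w n \<ge> 0" for n
    unfolding weight_sum_def by (rule sum_nonneg) (use w in \<open>auto intro: less_imp_le\<close>)
  have x_nonneg: "x n \<ge> 0" for n
    unfolding x_def weighted_sum_def
    by (intro divide_nonneg_nonneg sum_nonneg L_nonneg mult_nonneg_nonneg)
      (use a w in \<open>auto intro: less_imp_le\<close>)
  have L_pos: "weight_sum w n > 0" if "n \<ge> 1" for n
    unfolding weight_sum_def by (rule sum_pos) (use that w in auto)
  \<comment> \<open>At \<open>n = 0\<close> both sums are empty, so this survives the division by
    zero in \<open>x 0\<close>, and the passage from 0 to 1 needs no separate treatment.\<close>
  have mean: "weighted_sum w a n = weight_sum w n * x n" for n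
  proof (cases n)
    case 0
    then show ?thesis by (simp add: weighted_sum_def weight_sum_def)
  next
    case (Suc m)
    then show ?thesis using L_pos[of n] by (simp add: x_def)
  qed
  have L_Suc: "weight_sum w (Suc N) = weight_sum w N + w (Suc N)"
    by (simp add: weight_sum_def)
  have increment: "w (Suc N) * a (Suc N) = weight_sum w (Suc N) * x (Suc N) - weight_sum w N * x N"
    unfolding mean[symmetric] by (simp add: weighted_sum_def)
  have x_powr: "x (Suc N) * x (Suc N) powr (p - 1) = x (Suc N) powr p"
    using x_nonneg[of "Suc N"] p powr_mult_base[of "x (Suc N)" "p - 1"] by simp
  have "p * (w (Suc N) * a (Suc N) * x (Suc N) powr (p - 1))
      = p * weight_sum w (Suc N) * x (Suc N) powr p
        - weight_sum w N * (p * x N * x (Suc N) powr (p - 1))"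
    unfolding increment x_powr[symmetric] by (simp add: algebra_simps)
  also have "\<dots> \<ge> p * weight_sum w (Suc N) * x (Suc N) powr p
        - weight_sum w N * ((p - 1) * x (Suc N) powr p + x N powr p)"
    using mult_left_mono[OF Young_powr[OF p x_nonneg x_nonneg] L_nonneg] by simp
  \<comment> \<open>The coefficients of \<open>x (Suc N) powr p\<close> combine by
    \<open>p * (L + v) - (p - 1) * L = (p - 1) * v + (L + v)\<close>, where
    \<open>L = weight_sum w N\<close> and \<open>v = w (Suc N)\<close>. The boundary term at
    \<open>N\<close> then cancels against the induction hypothesis.\<close>
  finally have "(p - 1) * (w (Suc N) * x (Suc N) powr p) + weight_sum w (Suc N) * x (Suc N) powr p
      \<le> p * (w (Suc N) * a (Suc N) * x (Suc N) powr (p - 1)) + weight_sum w N * x N powr p"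
    unfolding L_Suc by (simp add: algebra_simps)
  with Suc.IH[folded x_def] show ?case
    by (simp add: x_def[symmetric] distrib_left)
qed

theorem theorem2:
  fixes p :: real and a w :: "nat \<Rightarrow> real" and N :: nat
  assumes "p > 1"
    and "\<And>n. n \<ge> 1 \<Longrightarrow> a n \<ge> 0"
    and "\<And>n. n \<ge> 1 \<Longrightarrow> w n > 0"
    and "N \<ge> 1"
  shows "(\<Sum>n=1..N. w n * (weighted_sum w a n / weight_sum w n) powr p)
    \<le> p / (p - 1) * (\<Sum>n=1..N. w n * a n * (weighted_sum w a n / weight_sum w n) powr (p - 1))
      - 1 / (p - 1) * weight_sum w N * (weighted_sum w a N / weight_sum w N) powr p"
proof -
  let ?x = "\<lambda>n. weighted_sum w a n / weight_sum w n"
  let ?S = "\<Sum>n=1..N. w n * ?x n powr p"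
  let ?T = "\<Sum>n=1..N. w n * a n * ?x n powr (p - 1)"
  let ?R = "weight_sum w N * ?x N powr p"
  have "(p - 1) * ?S + ?R \<le> p * ?T"
    using assms(1-3) by (rule weighted_mean_sum_powr_le)
  then have "?S \<le> (p * ?T - ?R) / (p - 1)"
    using assms(1) by (simp add: pos_le_divide_eq mult.commute)
  then show ?thesis
    by (simp add: diff_divide_distrib)
qed

end
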